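(* Let $l,r\ge 0$ be integers and let $S$ be the $(p,m,2)$ signed graph consisting of a positive edge, to which are attached $l$ positive pendant edges and $2$ negative pendant edges at one end as well as $r$ positive pendant edges at the other end. If $l=r-2$ then $S$ is additively graceful.
   Context: A signed graph $S$ is a finite simple graph on $p$ vertices in which $m$ edges are specified as positive and the remaining $n$ edges are specified as negative; it is then called a $(p,m,n)$ signed graph, with sets of positive and negative edges $E^+(S)$ and $E^-(S)$. Attaching a pendant edge at a vertex $z$ means adding a new vertex of degree 1 joined to $z$. Thus $S$ has positive edges $z_1z_2$, $z_1v_i$ ($1\le i\le l$), $z_2w_i$ ($1\le i\le r$) and negative edges $z_1u_1$, $z_1u_2$, all these vertices being distinct, and no other vertices or edges. An additively graceful labeling of a $(p,m,n)$ signed graph $S=(V,E)$ is an injective map $f:V\to\{0,1,\dots,m+\lceil\frac{n+1}{2}\rceil\}$ such that, with $f^*(uv)=f(u)+f(v)$ for $uv\in E^-(S)$ and $f^*(uv)=|f(u)-f(v)|$ for $uv\in E^+(S)$, one has $\{f^*(uv):uv\in E^-(S)\}=\{1,2,\dots,n\}$ and $\{f^*(uv):uv\in E^+(S)\}=\{1,2,\dots,m\}$. $S$ is additively graceful if it admits such a labeling. *)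

theory Defs
  imports Complex_Main
begin

record 'a sgraph =
  verts :: "'a set"
  pos_edges :: "'a set set"
  neg_edges :: "'a set set"

definition signed_graph :: "'a sgraph \<Rightarrow> bool" where
  "signed_graph S \<longleftrightarrow> finite (verts S) \<and>
     pos_edges S \<union> neg_edges S \<subseteq> {{x, y} | x y. x \<in> verts S \<and> y \<in> verts S \<and> x \<noteq> y} \<and>
     pos_edges S \<inter> neg_edges S = {}"

definition pmn_signed_graph :: "nat \<Rightarrow> nat \<Rightarrow> nat \<Rightarrow> 'a sgraph \<Rightarrow> bool" where
  "pmn_signed_graph p m n S \<longleftrightarrow> signed_graph S \<and>
     card (verts S) = p \<and> card (pos_edges S) = m \<and> card (neg_edges S) = n"

text \<open>Labels are integers, so that differences do not truncate; the range condition makes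
  them nonnegative.\<close>

definition additively_graceful_labeling :: "'a sgraph \<Rightarrow> ('a \<Rightarrow> int) \<Rightarrow> bool" where
  "additively_graceful_labeling S f \<longleftrightarrow>
     (let m = card (pos_edges S); n = card (neg_edges S) in
        inj_on f (verts S) \<and>
        f ` verts S \<subseteq> {0..int m + \<lceil>(real n + 1) / 2\<rceil>} \<and>
        {f x + f y | x y. {x, y} \<in> neg_edges S} = {1..int n} \<and>
        {\<bar>f x - f y\<bar> | x y. {x, y} \<in> pos_edges S} = {1..int m})"

definition additively_graceful :: "'a sgraph \<Rightarrow> bool" where
  "additively_graceful S \<longleftrightarrow> (\<exists>f. additively_graceful_labeling S f)"

text \<open>The positive edge is \<open>z1 z2\<close>; \<open>vs\<close> and \<open>ws\<close> list the ends of the positive pendant edges at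
  \<open>z1\<close> and \<open>z2\<close> respectively, and the negative pendant edges \<open>z1 u1\<close>, \<open>z1 u2\<close> are at \<open>z1\<close>.\<close>

definition signed_double_star :: "nat \<Rightarrow> nat \<Rightarrow> 'a sgraph \<Rightarrow> bool" where
  "signed_double_star l r S \<longleftrightarrow>
     (\<exists>z1 z2 u1 u2 vs ws.
        length vs = l \<and> length ws = r \<and>
        distinct ([z1, z2, u1, u2] @ vs @ ws) \<and>
        verts S = set ([z1, z2, u1, u2] @ vs @ ws) \<and>
        pos_edges S = {{z1, z2}} \<union> {{z1, v} | v. v \<in> set vs} \<union> {{z2, w} | w. w \<in> set ws} \<and>
        neg_edges S = {{z1, u1}, {z1, u2}})"

lemma signed_double_star_pmn:
  assumes "signed_double_star l r S"
  shows "pmn_signed_graph (l + r + 4) (l + r + 1) 2 S"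
proof -
  from assms obtain z1 z2 u1 u2 vs ws where
    len: "length vs = l" "length ws = r" and
    dist: "distinct ([z1, z2, u1, u2] @ vs @ ws)" and
    V: "verts S = set ([z1, z2, u1, u2] @ vs @ ws)" and
    P: "pos_edges S = {{z1, z2}} \<union> {{z1, v} | v. v \<in> set vs} \<union> {{z2, w} | w. w \<in> set ws}" and
    N: "neg_edges S = {{z1, u1}, {z1, u2}}"
    unfolding signed_double_star_def by (elim exE conjE) rule
  let ?A = "(\<lambda>v. {z1, v}) ` set vs" and ?B = "(\<lambda>w. {z2, w}) ` set ws"
  have P': "pos_edges S = insert {z1, z2} (?A \<union> ?B)"
    unfolding P by (simp add: image_def Setcompr_eq_image)
  have d: "z1 \<noteq> z2" "z1 \<noteq> u1" "z1 \<noteq> u2" "z2 \<noteq> u1" "z2 \<noteq> u2" "u1 \<noteq> u2"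
    "z1 \<notin> set vs" "z1 \<notin> set ws" "z2 \<notin> set vs" "z2 \<notin> set ws"
    "u1 \<notin> set vs" "u2 \<notin> set vs" "distinct vs" "distinct ws"
    using dist by simp_all
  have "inj_on (\<lambda>v. {z1, v}) (set vs)" "inj_on (\<lambda>w. {z2, w}) (set ws)"
    by (simp_all add: inj_on_def doubleton_eq_iff)
  then have cards: "card ?A = l" "card ?B = r"
    using d len by (simp_all add: card_image distinct_card)
  have disj: "?A \<inter> ?B = {}"
  proof (rule equals0I)
    fix e assume "e \<in> ?A \<inter> ?B"
    then have "z1 \<in> e" "e \<in> ?B" by blast+
    then show False using d by blast
  qed
  have "{z1, z2} \<notin> ?A \<union> ?B"
  proof
    assume "{z1, z2} \<in> ?A \<union> ?B"
    then show False using d by (elim UnE imageE) (simp_all add: doubleton_eq_iff)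
  qed
  then have "card (pos_edges S) = l + r + 1"
    unfolding P' using disj cards by (simp add: card_Un_disjoint)
  moreover have "card (neg_edges S) = 2"
    unfolding N using d by (simp add: doubleton_eq_iff)
  moreover have "card (verts S) = l + r + 4"
    unfolding V distinct_card[OF dist] using len by simp
  moreover have "pos_edges S \<union> neg_edges S
      \<subseteq> {{x, y} | x y. x \<in> verts S \<and> y \<in> verts S \<and> x \<noteq> y}" (is "_ \<subseteq> ?E")
  proof -
    have E: "{x, y} \<in> ?E" if "x \<in> verts S" "y \<in> verts S" "x \<noteq> y" for x y
      using that by blast
    have "?A \<subseteq> ?E" "?B \<subseteq> ?E"
      using d by (intro image_subsetI E; simp add: V; metis)+
    moreover have "{z1, z2} \<in> ?E" "{z1, u1} \<in> ?E" "{z1, u2} \<in> ?E"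
      by (intro E; simp add: V d)+
    ultimately show ?thesis
      unfolding P' N by simp
  qed
  moreover have "pos_edges S \<inter> neg_edges S = {}"
  proof -
    have "{z1, u} \<notin> pos_edges S" if "u \<noteq> z1" "u \<noteq> z2" "u \<notin> set vs" for u
    proof
      assume "{z1, u} \<in> pos_edges S"
      then show False
        unfolding P' using that d by (elim insertE UnE imageE) (simp_all add: doubleton_eq_iff)
    qed
    from this[of u1] this[of u2] d show ?thesis
      unfolding N by simp
  qed
  moreover have "finite (verts S)"
    unfolding V by simp
  ultimately show ?thesis
    unfolding pmn_signed_graph_def signed_graph_def by (intro conjI)
qed

end

theory Submission imports Defs begin

text \<open>
  With \<open>r = l + 2\<close> the graph has \<open>m = 2 l + 3\<close> positive edges, the labels come from
  \<open>{0..2 l + 5}\<close>, and there are exactly as many vertices as labels, so a graceful labeling is a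
  bijection. The negative edges must have sums \<open>1\<close> and \<open>2\<close>. As \<open>1 = 0 + 1\<close> is the only way to
  reach \<open>1\<close>, the label of \<open>z1\<close> is \<open>0\<close> or \<open>1\<close>; with \<open>1\<close> the sum \<open>2\<close> would repeat a label, so
  \<open>z1\<close> has \<open>0\<close> and its negative leaves have \<open>1\<close> and \<open>2\<close>. Hence every positive edge at \<open>z1\<close> carries the label
  of its other end.

  Put \<open>l + 3\<close> at \<open>z2\<close>, give the leaves of \<open>z1\<close> the \<open>l\<close> labels \<open>l + 4, \<dots>, 2 l + 3\<close>, and the
  leaves of \<open>z2\<close> all that remain: \<open>3, \<dots>, l + 2\<close> and \<open>2 l + 4\<close>, \<open>2 l + 5\<close>. The positive edges at
  \<open>z1\<close> then carry \<open>l + 3, \<dots>, 2 l + 3\<close>. Those at \<open>z2\<close> carry the distances to \<open>l + 3\<close>, which are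
  \<open>l, \<dots>, 1\<close> on the low block and \<open>l + 1\<close>, \<open>l + 2\<close> on the two top labels. Together these are
  \<open>1, \<dots>, 2 l + 3\<close>, each once.
\<close>

lemma obtain_function_with_values:
  assumes "distinct xs" and "length ys = length xs"
  obtains f where "map f xs = ys"
proof -
  have "map (\<lambda>x. the (map_of (zip xs ys) x)) xs = ys"
    using assms by (auto intro!: nth_equalityI simp: map_of_zip_nth)
  then show thesis by (rule that)
qed

text \<open>An edge is an unordered pair, so a set of edge values ranges over both orientations of
  each edge; for a symmetric edge function, orienting every edge of a star away from its centre
  already gives all values.\<close>

lemma edge_values_star:
  assumes "\<And>x y. h x y = h y x"
  shows "{h x y | x y. {x, y} \<in> (\<lambda>a. {c, a}) ` A} = h c ` A"
proof (intro equalityI subsetI)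
  fix t assume "t \<in> {h x y | x y. {x, y} \<in> (\<lambda>a. {c, a}) ` A}"
  then obtain x y a where "t = h x y" "{x, y} = {c, a}" "a \<in> A"
    by blast
  then have "t = h c a"
    using assms[of a c] by (auto simp: doubleton_eq_iff)
  with \<open>a \<in> A\<close> show "t \<in> h c ` A"
    by blast
qed blast

lemma edge_values_Un:
  "{h x y | x y. {x, y} \<in> E \<union> F} = {h x y | x y. {x, y} \<in> E} \<union> {h x y | x y. {x, y} \<in> F}"
  by blast

lemma distances_to_centre_label:
  "(\<lambda>k. \<bar>int l + 3 - k\<bar>) ` ({3..int l + 2} \<union> {2 * int l + 4, 2 * int l + 5}) = {1..int l + 2}"
proof (intro equalityI subsetI)
  fix d assume "d \<in> {1..int l + 2}"
  then consider "1 \<le> d" "d \<le> int l" | "d = int l + 1" | "d = int l + 2"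
    by fastforce
  then show "d \<in> (\<lambda>k. \<bar>int l + 3 - k\<bar>) `
      ({3..int l + 2} \<union> {2 * int l + 4, 2 * int l + 5})"
  proof cases
    case 1
    then show ?thesis by (intro image_eqI[where x = "int l + 3 - d"]) auto
  qed auto
qed auto

theorem theorem4p2:
  fixes S :: "'a sgraph" and l r p m :: nat
  assumes "pmn_signed_graph p m 2 S"
    and "signed_double_star l r S"
    and "int l = int r - 2"
  shows "additively_graceful S"
proof -
  have r: "r = l + 2"
    using assms(3) by linarith
  have "pmn_signed_graph (l + r + 4) (l + r + 1) 2 S"
    using assms(2) by (rule signed_double_star_pmn)
  then have card_pos: "card (pos_edges S) = 2 * l + 3" and card_neg: "card (neg_edges S) = 2"
    unfolding pmn_signed_graph_def r by simp_all
  from assms(2) obtain z1 z2 u1 u2 vs ws where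
    len: "length vs = l" "length ws = r" and
    dist: "distinct ([z1, z2, u1, u2] @ vs @ ws)" and
    V: "verts S = set ([z1, z2, u1, u2] @ vs @ ws)" and
    P: "pos_edges S = {{z1, z2}} \<union> {{z1, v} | v. v \<in> set vs} \<union> {{z2, w} | w. w \<in> set ws}" and
    N: "neg_edges S = {{z1, u1}, {z1, u2}}"
    unfolding signed_double_star_def by (elim exE conjE) rule
  define A where "A = [int l + 4..2 * int l + 3]"
  define B where "B = [3..int l + 2] @ [2 * int l + 4, 2 * int l + 5]"
  have lenAB: "length A = length vs" "length B = length ws"
    unfolding A_def B_def len r by simp_all
  then have "length ([0, int l + 3, 1, 2] @ A @ B) = length ([z1, z2, u1, u2] @ vs @ ws)"
    by simp
  with dist obtain f where
    f: "map f ([z1, z2, u1, u2] @ vs @ ws) = [0, int l + 3, 1, 2] @ A @ B"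
    by (rule obtain_function_with_values)
  then have fz: "f z1 = 0" "f z2 = int l + 3" "f u1 = 1" "f u2 = 2"
    and "map f vs = A" "map f ws = B"
    using lenAB by simp_all
  then have fvs: "f ` set vs = {int l + 4..2 * int l + 3}"
    and fws: "f ` set ws = {3..int l + 2} \<union> {2 * int l + 4, 2 * int l + 5}"
    unfolding A_def B_def by (simp_all flip: set_map)

  have "inj_on f (verts S)"
  proof -
    have "distinct ([0, int l + 3, 1, 2] @ A @ B)"
      unfolding A_def B_def by auto
    then show ?thesis
      unfolding V f[symmetric] by (simp only: distinct_map)
  qed
  moreover have "f ` verts S \<subseteq> {0..int (2 * l + 3) + \<lceil>(real 2 + 1) / 2\<rceil>}"
  proof -
    have "\<lceil>(real 2 + 1) / 2\<rceil> = 2"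
      by (simp add: ceiling_eq_iff)
    then show ?thesis
      unfolding V by (auto simp: image_Un fz fvs fws)
  qed
  moreover have "{f x + f y | x y. {x, y} \<in> neg_edges S} = {1..int 2}"
  proof -
    have "neg_edges S = (\<lambda>u. {z1, u}) ` {u1, u2}"
      unfolding N by simp
    then have "{f x + f y | x y. {x, y} \<in> neg_edges S} = (\<lambda>u. f z1 + f u) ` {u1, u2}"
      by (simp only: edge_values_star[of "\<lambda>x y. f x + f y", OF add.commute])
    also have "\<dots> = {1..int 2}"
      using fz by auto
    finally show ?thesis .
  qed
  moreover have "{\<bar>f x - f y\<bar> | x y. {x, y} \<in> pos_edges S} = {1..int (2 * l + 3)}"
  proof -
    have "pos_edges S = (\<lambda>v. {z1, v}) ` insert z2 (set vs) \<union> (\<lambda>w. {z2, w}) ` set ws"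
      unfolding P by blast
    then have "{\<bar>f x - f y\<bar> | x y. {x, y} \<in> pos_edges S} =
        (\<lambda>v. \<bar>f z1 - f v\<bar>) ` insert z2 (set vs) \<union> (\<lambda>w. \<bar>f z2 - f w\<bar>) ` set ws"
      by (simp only: edge_values_Un edge_values_star[of "\<lambda>x y. \<bar>f x - f y\<bar>", OF abs_minus_commute])
    also have "(\<lambda>v. \<bar>f z1 - f v\<bar>) ` insert z2 (set vs) = {int l + 3..2 * int l + 3}"
    proof -
      have "(\<lambda>v. \<bar>f z1 - f v\<bar>) ` insert z2 (set vs) = abs ` f ` insert z2 (set vs)"
        by (simp add: image_image fz)
      also have "f ` insert z2 (set vs) = {int l + 3..2 * int l + 3}"
        by (auto simp: fz fvs)
      also have "abs ` {int l + 3..2 * int l + 3} = {int l + 3..2 * int l + 3}"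
        by (simp cong: image_cong_simp)
      finally show ?thesis .
    qed
    also have "(\<lambda>w. \<bar>f z2 - f w\<bar>) ` set ws = {1..int l + 2}"
    proof -
      have "(\<lambda>w. \<bar>f z2 - f w\<bar>) ` set ws = (\<lambda>k. \<bar>int l + 3 - k\<bar>) ` f ` set ws"
        by (simp add: image_image fz)
      then show ?thesis
        by (simp only: fws distances_to_centre_label)
    qed
    also have "{int l + 3..2 * int l + 3} \<union> {1..int l + 2} = {1..int (2 * l + 3)}"
      by auto
    finally show ?thesis .
  qed
  ultimately have "additively_graceful_labeling S f"
    unfolding additively_graceful_labeling_def card_pos card_neg Let_def by blast
  then show ?thesis
    unfolding additively_graceful_def by blast
qed

end
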